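(* Let $X$ be a real Hilbert space, $L>0$, $A:X\to X$ monotone and $L$-Lipschitz continuous, and $C\subset X$ a non-empty closed convex set with normal cone operator $N_C$ and orthogonal projection $P_C$. Let $0<\underline\lambda\le\bar\lambda<1/L$, let $(\lambda_k)_{k\ge1}$ be a sequence in $[\underline\lambda,\bar\lambda]$, let $x_0\in X$, and let $(x_k)$ be generated by Korpelevich's method $$y_k=P_C\bigl(x_{k-1}-\lambda_kA(x_{k-1})\bigr),\qquad x_k=P_C\bigl(x_{k-1}-\lambda_kA(y_k)\bigr),\qquad k=1,2,\dots$$ For $\lambda>0$ define $H_\lambda:X\to X\times X$, $H_\lambda(x)=\bigl(x,P_C(x-\lambda A(x))\bigr)$ and $G_\lambda:X\times X\to X$, $G_\lambda(x,y)=P_C(x-\lambda A(y))$, and let $\sigma=\bar\lambda L$. Then $0<\sigma<1$ and for any $x\in X$, $$G_{\lambda_k}\circ H_{\lambda_k}(x)\in J_{\lambda_k(A+N_C),\sigma}(x),\qquad k=1,2,\dots$$ In particular, $$x_k=G_{\lambda_k}\circ H_{\lambda_k}(x_{k-1})\in J_{\lambda_k(A+N_C),\sigma}(x_{k-1}),\qquad k=1,2,\dots,$$ and the sequence of maps $(G_{\lambda_k}\circ H_{\lambda_k})_{k\ge1}$ satisfies properties P1 and P2 with respect to $(A+N_C)^{-1}(0)$.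
   Context: For maximal monotone $T:X\rightrightarrows X$ (point-to-set) and $\varepsilon\ge 0$, $$T^{[\varepsilon]}(x)=\{v\in X : \langle x-y,v-u\rangle\ge-\varepsilon\ \text{ for all } y\in X,\ u\in T(y)\}.$$ For $\sigma\ge 0$, the $\sigma$-approximate resolvent of $T$ is the point-to-set map $$J_{T,\sigma}(x)=\{x-v : \exists\,\varepsilon\ge 0,\ y\in X \text{ with } v\in T^{[\varepsilon]}(y),\ \|v+y-x\|^2+2\varepsilon\le\sigma^2\|y-x\|^2\}.$$ Properties of a sequence $(F_n:X\rightrightarrows X)_{n\in\mathbb N}$ of point-to-set maps with respect to $\Omega\subset X$ (a single-valued map is identified with a singleton-valued point-to-set map): P1: if $\hat x\in F_n(x)$ (for some $n$ and $x\in X$) and $x^*\in\Omega$, then $\|x^*-\hat x\|\le\|x^*-x\|$. P2: if $(z_k)_{k\in\mathbb N}$ converges weakly to $\bar z$, $\hat z_k\in F_{n_k}(z_k)$ for all $k$ with $n_1<n_2<\cdots$, and for some $x^*\in\Omega$ one has $\lim_{k\to\infty}\left(\|x^*-z_k\|-\|x^*-\hat z_k\|\right)=0$, then $\bar z\in\Omega$. $(A+N_C)^{-1}(0)=\{x\in X : 0\in A(x)+N_C(x)\}$. *)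

theory Defs
  imports "HOL-Analysis.Analysis"
begin

(* A real Hilbert space is a type of sort {real_inner, complete_space}. A point-to-set map
   on X = 'a is a function 'a => 'a set, and singleton_map identifies a map f : X -> X with
   the singleton-valued point-to-set map x |-> {f x}. *)

definition singleton_map :: "('a \<Rightarrow> 'a) \<Rightarrow> 'a \<Rightarrow> 'a set" where
  "singleton_map f = (\<lambda>x. {f x})"

definition op_add :: "('a::plus \<Rightarrow> 'a set) \<Rightarrow> ('a \<Rightarrow> 'a set) \<Rightarrow> 'a \<Rightarrow> 'a set" where
  "op_add S T = (\<lambda>x. {u + v | u v. u \<in> S x \<and> v \<in> T x})"

definition op_scale :: "real \<Rightarrow> ('a::real_vector \<Rightarrow> 'a set) \<Rightarrow> 'a \<Rightarrow> 'a set" where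
  "op_scale c T = (\<lambda>x. {c *\<^sub>R v | v. v \<in> T x})"

definition op_zeros :: "('a::zero \<Rightarrow> 'a set) \<Rightarrow> 'a set" where
  "op_zeros T = {x. 0 \<in> T x}"

definition monotone_operator :: "('a::real_inner \<Rightarrow> 'a set) \<Rightarrow> bool" where
  "monotone_operator T \<longleftrightarrow>
     (\<forall>x y. \<forall>u\<in>T x. \<forall>v\<in>T y. 0 \<le> inner (x - y) (u - v))"

definition normal_cone :: "'a::real_inner set \<Rightarrow> 'a \<Rightarrow> 'a set" where
  "normal_cone C x = (if x \<in> C then {v. \<forall>y\<in>C. inner v (y - x) \<le> 0} else {})"

(* The library's closest_point requires heine_borel, hence excludes infinite dimension. *)
definition hilbert_proj :: "'a::{real_inner, complete_space} set \<Rightarrow> 'a \<Rightarrow> 'a" where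
  "hilbert_proj C x = (THE p. p \<in> C \<and> (\<forall>q\<in>C. dist x p \<le> dist x q))"

definition enlargement :: "real \<Rightarrow> ('a::real_inner \<Rightarrow> 'a set) \<Rightarrow> 'a \<Rightarrow> 'a set" where
  "enlargement \<epsilon> T x = {v. \<forall>y. \<forall>u\<in>T y. inner (x - y) (v - u) \<ge> - \<epsilon>}"

definition approx_resolvent :: "('a::real_inner \<Rightarrow> 'a set) \<Rightarrow> real \<Rightarrow> 'a \<Rightarrow> 'a set" where
  "approx_resolvent T \<sigma> x =
     {x - v | v. \<exists>\<epsilon>\<ge>0. \<exists>y. v \<in> enlargement \<epsilon> T y \<and>
        (norm (v + y - x))\<^sup>2 + 2 * \<epsilon> \<le> \<sigma>\<^sup>2 * (norm (y - x))\<^sup>2}"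

definition weakly_converges :: "(nat \<Rightarrow> 'a::real_normed_vector) \<Rightarrow> 'a \<Rightarrow> bool" where
  "weakly_converges z l \<longleftrightarrow>
     (\<forall>f :: 'a \<Rightarrow> real. bounded_linear f \<longrightarrow> (\<lambda>k. f (z k)) \<longlonglongrightarrow> f l)"

(* Sequences of maps F are indexed by n = 1, 2, ...; the value F 0 plays no role.
   The sequences z, w, n in property_P2 are instead enumerated from 0. *)

definition property_P1 :: "(nat \<Rightarrow> 'a::real_normed_vector \<Rightarrow> 'a set) \<Rightarrow> 'a set \<Rightarrow> bool" where
  "property_P1 F \<Omega> \<longleftrightarrow>
     (\<forall>n\<ge>1. \<forall>x. \<forall>w\<in>F n x. \<forall>s\<in>\<Omega>. norm (s - w) \<le> norm (s - x))"

definition property_P2 :: "(nat \<Rightarrow> 'a::real_normed_vector \<Rightarrow> 'a set) \<Rightarrow> 'a set \<Rightarrow> bool" where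
  "property_P2 F \<Omega> \<longleftrightarrow>
     (\<forall>z w l n. weakly_converges z l \<longrightarrow>
        strict_mono n \<longrightarrow> (\<forall>k. 1 \<le> n k) \<longrightarrow> (\<forall>k. w k \<in> F (n k) (z k)) \<longrightarrow>
        (\<exists>s\<in>\<Omega>. (\<lambda>k. norm (s - z k) - norm (s - w k)) \<longlonglongrightarrow> 0) \<longrightarrow>
        l \<in> \<Omega>)"

definition korpelevich_H ::
  "'a::{real_inner, complete_space} set \<Rightarrow> ('a \<Rightarrow> 'a) \<Rightarrow> real \<Rightarrow> 'a \<Rightarrow> 'a \<times> 'a" where
  "korpelevich_H C A c x = (x, hilbert_proj C (x - c *\<^sub>R A x))"

definition korpelevich_G ::
  "'a::{real_inner, complete_space} set \<Rightarrow> ('a \<Rightarrow> 'a) \<Rightarrow> real \<Rightarrow> 'a \<times> 'a \<Rightarrow> 'a" where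
  "korpelevich_G C A c = (\<lambda>(x, y). hilbert_proj C (x - c *\<^sub>R A y))"

end

theory Submission
  imports Defs
begin

text \<open>
  With \<open>y = P\<^sub>C (x - \<lambda> A x)\<close> and \<open>p = P\<^sub>C (x - \<lambda> A y)\<close>, the vector \<open>x - \<lambda> A y - p\<close> is normal to
  \<open>C\<close> at \<open>p\<close>, hence \<open>\<epsilon>\<close>-normal at \<open>y\<close> with \<open>\<epsilon> = \<langle>x - \<lambda> A y - p, p - y\<rangle>\<close>; so \<open>x - p\<close> lies in the
  \<open>\<epsilon>\<close>-enlargement of \<open>\<lambda> (A + N\<^sub>C)\<close> at \<open>y\<close>. The variational inequality for \<open>y\<close> and the Lipschitz
  bound give the error criterion of the approximate resolvent. That criterion yields
  \<open>\<parallel>s - p\<parallel>\<^sup>2 \<le> \<parallel>s - x\<parallel>\<^sup>2 - (1 - \<sigma>\<^sup>2) \<parallel>y - x\<parallel>\<^sup>2\<close> for every zero \<open>s\<close>, which is P1. In P2 it forces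
  \<open>\<parallel>y\<^sub>k - z\<^sub>k\<parallel> \<rightarrow> 0\<close> because weakly convergent sequences are bounded; monotonicity then gives
  \<open>\<langle>A q, q - l\<rangle> \<ge> 0\<close> for all \<open>q \<in> C\<close>, and Minty's trick turns this into \<open>- A l \<in> N\<^sub>C l\<close>.
\<close>

section \<open>Monotonicity, normal cones and zeros of operators\<close>

lemma singleton_map_monotoneD:
  assumes "monotone_operator (singleton_map A)"
  shows "0 \<le> inner (x - y) (A x - A y)"
  using assms by (auto simp: monotone_operator_def singleton_map_def)

lemma normal_coneD:
  "v \<in> normal_cone C x \<Longrightarrow> q \<in> C \<Longrightarrow> inner v (q - x) \<le> 0"
  by (auto simp: normal_cone_def split: if_splits)

lemma normal_cone_mem: "v \<in> normal_cone C x \<Longrightarrow> x \<in> C"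
  by (auto simp: normal_cone_def split: if_splits)

lemma mem_op_zeros_add_normal_cone:
  "s \<in> op_zeros (op_add (singleton_map A) (normal_cone C)) \<longleftrightarrow> - A s \<in> normal_cone C s"
proof -
  have "0 = A s + v \<longleftrightarrow> v = - A s" for v
    by (metis add.inverse_inverse eq_neg_iff_add_eq_0 minus_unique)
  then show ?thesis
    by (auto simp: op_zeros_def op_add_def singleton_map_def)
qed

lemma op_zeros_op_scale: "s \<in> op_zeros T \<Longrightarrow> s \<in> op_zeros (op_scale c T)"
  by (force simp: op_zeros_def op_scale_def)

subsection \<open>The projection onto a closed convex set\<close>

text \<open>The sets \<open>S n\<close> of near-minimisers of the squared distance are closed and
  nested, and the parallelogram law makes their diameters tend to 0. Completeness yields a common
  point, whose squared distance is \<open>Inf D\<close>.\<close>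

lemma closest_point_exists_hilbert:
  fixes C :: "'a::{real_inner, complete_space} set"
  assumes "C \<noteq> {}" "closed C" "convex C"
  shows "\<exists>p\<in>C. \<forall>q\<in>C. dist x p \<le> dist x q"
proof -
  define D where "D = (\<lambda>p. (norm (x - p))\<^sup>2) ` C"
  define S where "S n = {p \<in> C. (norm (x - p))\<^sup>2 \<le> Inf D + 1 / real (Suc n)}" for n
  have bdd: "bdd_below D"
    by (rule bdd_belowI[of _ 0]) (auto simp: D_def)
  have Inf_le: "Inf D \<le> (norm (x - p))\<^sup>2" if "p \<in> C" for p
    using that bdd by (auto simp: D_def intro: cInf_lower)
  have close: "(norm (p - q))\<^sup>2 \<le> 4 / real (Suc n)" if "p \<in> S n" "q \<in> S n" for p q n
  proof -
    let ?m = "(1/2) *\<^sub>R p + (1/2) *\<^sub>R q"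
    have "?m \<in> C"
      using that \<open>convex C\<close> by (intro convexD) (auto simp: S_def)
    \<comment> \<open>Parallelogram law. The midpoint lies in \<open>C\<close>, so its squared
      distance is at least \<open>Inf D\<close>; the four copies of \<open>Inf D\<close> cancel and
      only the slack \<open>4 / real (Suc n)\<close> remains.\<close>
    moreover have "(norm (p - q))\<^sup>2
        = 2 * (norm (x - p))\<^sup>2 + 2 * (norm (x - q))\<^sup>2 - 4 * (norm (x - ?m))\<^sup>2"
      by (simp add: power2_norm_eq_inner inner_diff inner_add inner_commute algebra_simps)
    ultimately show ?thesis
      using that Inf_le[of ?m] by (simp add: S_def)
  qed
  obtain p where p: "\<And>n. p \<in> S n"
  proof (rule decreasing_closed_nest[of S])
    fix n
    have "S n = C \<inter> {p. (norm (x - p))\<^sup>2 \<le> Inf D + 1 / real (Suc n)}"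
      by (auto simp: S_def)
    moreover have "closed {p. (norm (x - p))\<^sup>2 \<le> Inf D + 1 / real (Suc n)}"
      by (intro closed_Collect_le continuous_intros)
    ultimately show "closed (S n)"
      using \<open>closed C\<close> by auto
  next
    fix n
    have "D \<noteq> {}"
      using assms by (auto simp: D_def)
    then obtain d where "d \<in> D" "d < Inf D + 1 / real (Suc n)"
      using cInf_lessD[of D "Inf D + 1 / real (Suc n)"] by auto
    then show "S n \<noteq> {}"
      by (auto simp: D_def S_def intro: less_imp_le)
  next
    fix m n :: nat
    assume "m \<le> n"
    then have "1 / real (Suc n) \<le> 1 / real (Suc m)"
      by (intro divide_left_mono) auto
    then show "S n \<subseteq> S m"
      by (auto simp: S_def)
  next
    fix e :: real
    assume "e > 0"
    then obtain n where n: "inverse (real (Suc n)) < e\<^sup>2 / 4"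
      using reals_Archimedean[of "e\<^sup>2 / 4"] by auto
    have "dist p q < e" if "p \<in> S n" "q \<in> S n" for p q
    proof -
      have "(norm (p - q))\<^sup>2 < e\<^sup>2"
        using close[OF that] n unfolding inverse_eq_divide by linarith
      then show ?thesis
        using \<open>e > 0\<close> by (simp add: dist_norm power_less_imp_less_base)
    qed
    then show "\<exists>n. \<forall>p\<in>S n. \<forall>q\<in>S n. dist p q < e"
      by blast
  qed blast
  have "(\<lambda>n. Inf D + 1 / real (Suc n)) \<longlonglongrightarrow> Inf D + 0"
    by (intro tendsto_add tendsto_const LIMSEQ_Suc[OF lim_1_over_n])
  then have "(norm (x - p))\<^sup>2 \<le> Inf D"
    using p by (intro LIMSEQ_le_const[of _ "Inf D"]) (auto simp: S_def)
  then have "(norm (x - p))\<^sup>2 \<le> (norm (x - q))\<^sup>2" if "q \<in> C" for q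
    using Inf_le[OF that] by linarith
  then have "\<forall>q\<in>C. dist x p \<le> dist x q"
    by (auto simp: dist_norm power2_le_iff_abs_le)
  with p[of 0] show ?thesis
    by (auto simp: S_def)
qed

text \<open>Existence and uniqueness of the nearest point make the description in
  \<open>hilbert_proj\<close> denote; the obtuse-angle inequality is then membership in the normal
  cone. Every later use of the projection goes through this fact.\<close>

lemma hilbert_proj_normal_cone:
  assumes "C \<noteq> {}" "closed C" "convex C"
  shows "x - hilbert_proj C x \<in> normal_cone C (hilbert_proj C x)"
proof -
  have "\<exists>!p. p \<in> C \<and> (\<forall>q\<in>C. dist x p \<le> dist x q)"
    using closest_point_exists_hilbert[OF assms, of x] any_closest_point_unique[OF assms(3,2)]
    by blast
  from theI'[OF this] have "hilbert_proj C x \<in> C" "\<forall>q\<in>C. dist x (hilbert_proj C x) \<le> dist x q"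
    by (auto simp: hilbert_proj_def)
  then show ?thesis
    using any_closest_point_dot[OF assms(3,2)] by (auto simp: normal_cone_def)
qed

subsection \<open>Weak convergence\<close>

lemma weakly_converges_inner:
  fixes z :: "nat \<Rightarrow> 'a::real_inner"
  assumes "weakly_converges z l"
  shows "(\<lambda>k. inner u (z k)) \<longlonglongrightarrow> inner u l"
  using assms bounded_linear_inner_right[of u] by (auto simp: weakly_converges_def)

text \<open>Uniform boundedness via Baire: the closed sets \<open>{u. \<forall>k. \<bar>\<langle>u, z\<^sub>k\<rangle>\<bar> \<le> n}\<close> cover the space.\<close>

lemma weakly_converges_bounded:
  fixes z :: "nat \<Rightarrow> 'a::{real_inner, complete_space}"
  assumes "weakly_converges z l"
  shows "\<exists>B. \<forall>k. norm (z k) \<le> B"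
proof -
  define E where "E n = {u. \<forall>k. \<bar>inner u (z k)\<bar> \<le> real n}" for n
  have closed_E: "closed (E n)" for n
    unfolding E_def by (intro closed_Collect_all closed_Collect_le continuous_intros)
  have "\<exists>n. u \<in> E n" for u
  proof -
    have "Bseq (\<lambda>k. inner u (z k))"
      using weakly_converges_inner[OF assms, of u] by (auto intro: convergent_imp_Bseq convergentI)
    then obtain K where K: "\<And>k. \<bar>inner u (z k)\<bar> \<le> K"
      by (auto simp: Bseq_def)
    obtain n where "K \<le> real n"
      using real_arch_simple by blast
    with K show ?thesis
      by (auto simp: E_def intro: order_trans)
  qed
  then have "\<Union>(range E) = UNIV"
    by auto
  moreover have "interior (\<Union>(range E)) = {}" if "\<And>n. interior (E n) = {}"
    using Met_TC.metric_Baire_category_alt[of "range E"] closed_E that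
    by (auto simp: complete_UNIV)
  ultimately obtain n where "interior (E n) \<noteq> {}"
    by fastforce
  then obtain a e where "e > 0" and ball: "cball a e \<subseteq> E n"
    by (metis all_not_in_conv mem_interior_cball)
  have "norm (z k) \<le> 2 * real n / e" for k
  proof (cases "z k = 0")
    case False
    \<comment> \<open>\<open>z k\<close> rescaled to length \<open>e\<close>: both \<open>a\<close>
      and \<open>a + u\<close> stay in the ball, and subtracting their bounds controls
      \<open>inner u (z k) = e * norm (z k)\<close> by \<open>2 * real n\<close>.\<close>
    define u where "u = (e / norm (z k)) *\<^sub>R z k"
    have "norm u = e"
      using False \<open>e > 0\<close> by (simp add: u_def)
    then have "a \<in> cball a e" "a + u \<in> cball a e"
      using \<open>e > 0\<close> by (auto simp: dist_norm)
    then have "a \<in> E n" "a + u \<in> E n"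
      using ball by blast+
    then have "\<bar>inner a (z k)\<bar> \<le> real n" "\<bar>inner (a + u) (z k)\<bar> \<le> real n"
      by (auto simp: E_def)
    moreover have "inner u (z k) = e * norm (z k)"
      using False by (simp add: u_def dot_square_norm power2_eq_square)
    ultimately have "e * norm (z k) \<le> 2 * real n"
      by (simp add: inner_add_left)
    then show ?thesis
      using \<open>e > 0\<close> by (simp add: field_simps)
  qed (use \<open>e > 0\<close> in simp)
  then show ?thesis
    by blast
qed

text \<open>Separation by the residual at the projection \<open>p\<close> of \<open>l\<close>: on
  \<open>C\<close> the functional \<open>inner (l - p)\<close> is at most its value at
  \<open>p\<close>. This passes to the weak limit, where it says that \<open>l - p\<close> has norm
  0.\<close>

lemma convex_closed_weak_limit:
  fixes w :: "nat \<Rightarrow> 'a::{real_inner, complete_space}"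
  assumes "closed C" "convex C" "\<And>k. w k \<in> C" and lim: "\<And>u. (\<lambda>k. inner u (w k)) \<longlonglongrightarrow> inner u l"
  shows "l \<in> C"
proof -
  have "C \<noteq> {}"
    using assms(3) by auto
  define p where "p = hilbert_proj C l"
  have p: "l - p \<in> normal_cone C p"
    using hilbert_proj_normal_cone[OF \<open>C \<noteq> {}\<close> assms(1,2)] by (simp add: p_def)
  have "(\<lambda>k. inner (l - p) (w k) - inner (l - p) p) \<longlonglongrightarrow> inner (l - p) l - inner (l - p) p"
    by (intro tendsto_diff lim tendsto_const)
  moreover have "inner (l - p) (w k) - inner (l - p) p \<le> 0" for k
    using normal_coneD[OF p assms(3)] by (simp add: inner_diff_right)
  ultimately have "inner (l - p) l - inner (l - p) p \<le> 0"
    by (intro LIMSEQ_le_const2) auto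
  then have "inner (l - p) (l - p) \<le> 0"
    by (simp add: inner_diff_right)
  then have "l = p"
    by (metis inner_eq_zero_iff inner_ge_zero order_antisym right_minus_eq)
  then show ?thesis
    using normal_cone_mem[OF p] by simp
qed

subsection \<open>One step of the method\<close>

text \<open>Testing the enlargement against the pair \<open>(s, 0)\<close> of the graph gives
  \<open>inner (y - s) v \<ge> - \<epsilon>\<close>. Expanding the square produces
  \<open>2 * \<epsilon>\<close>, which the error criterion absorbs.\<close>

lemma enlargement_step_decrease:
  assumes v: "v \<in> enlargement \<epsilon> T y"
    and err: "(norm (v + y - x))\<^sup>2 + 2 * \<epsilon> \<le> \<sigma>\<^sup>2 * (norm (y - x))\<^sup>2"
    and s: "s \<in> op_zeros T"
  shows "(norm (s - (x - v)))\<^sup>2 + (1 - \<sigma>\<^sup>2) * (norm (y - x))\<^sup>2 \<le> (norm (s - x))\<^sup>2"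
proof -
  have "- \<epsilon> \<le> inner (y - s) (v - 0)"
    using v s unfolding enlargement_def op_zeros_def by blast
  moreover have "(norm (s - (x - v)))\<^sup>2
      = (norm (s - x))\<^sup>2 - 2 * inner (y - s) v + (norm (v + y - x))\<^sup>2 - (norm (y - x))\<^sup>2"
    by (simp add: power2_norm_eq_inner inner_diff inner_add inner_commute algebra_simps)
  ultimately show ?thesis
    using err by (simp add: algebra_simps)
qed

text \<open>Moving the normal \<open>n\<close> from \<open>p\<close> to \<open>y\<close> costs
  \<open>inner n (p - y)\<close>, since \<open>inner n (q - p) \<le> 0\<close> for \<open>q\<close>
  in \<open>C\<close>. The remaining terms have the right sign by monotonicity of \<open>A\<close>
  and by normality of \<open>w\<close> at \<open>q\<close>.\<close>

lemma mem_enlargement_add_normal_cone: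
  assumes mono: "monotone_operator (singleton_map A)" and "0 \<le> c" "y \<in> C"
    and n: "n \<in> normal_cone C p"
  shows "c *\<^sub>R A y + n
    \<in> enlargement (inner n (p - y)) (op_scale c (op_add (singleton_map A) (normal_cone C))) y"
  unfolding enlargement_def
proof (intro CollectI allI ballI)
  fix q u
  assume "u \<in> op_scale c (op_add (singleton_map A) (normal_cone C)) q"
  then obtain w where u: "u = c *\<^sub>R (A q + w)" and w: "w \<in> normal_cone C q"
    by (auto simp: op_scale_def op_add_def singleton_map_def)
  have "0 \<le> c * inner (y - q) (A y - A q)"
    using singleton_map_monotoneD[OF mono] \<open>0 \<le> c\<close> by simp
  moreover have "c * inner w (y - q) \<le> 0"
    using normal_coneD[OF w \<open>y \<in> C\<close>] \<open>0 \<le> c\<close> by (simp add: mult_nonneg_nonpos)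
  moreover have "inner n (q - p) \<le> 0"
    using normal_coneD[OF n normal_cone_mem[OF w]] .
  ultimately show "- inner n (p - y) \<le> inner (y - q) (c *\<^sub>R A y + n - u)"
    by (simp add: u inner_diff inner_add inner_commute algebra_simps)
qed

lemma korpelevich_error:
  assumes lip: "L-lipschitz_on UNIV A" and c: "0 \<le> c" "c * L \<le> \<sigma>"
    and y: "x - c *\<^sub>R A x - y \<in> normal_cone C y" and p: "p \<in> C"
  shows "(norm (x - p + y - x))\<^sup>2 + 2 * inner (x - c *\<^sub>R A y - p) (p - y)
    \<le> \<sigma>\<^sup>2 * (norm (y - x))\<^sup>2"
proof -
  let ?d = "c *\<^sub>R (A x - A y)"
  have "inner (x - c *\<^sub>R A x - y) (p - y) \<le> 0"
    using normal_coneD[OF y p] .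
  \<comment> \<open>Completing the square: once the inequality at \<open>y\<close> is used, the left
    side is at most \<open>2 * inner ?d (p - y)\<close> minus the square of
    \<open>norm (p - y)\<close>, that is, the square of \<open>norm ?d\<close> minus this
    one.\<close>
  moreover have "0 \<le> (norm (p - y - ?d))\<^sup>2"
    by simp
  ultimately have "(norm (x - p + y - x))\<^sup>2 + 2 * inner (x - c *\<^sub>R A y - p) (p - y)
      \<le> (norm ?d)\<^sup>2"
    by (simp add: power2_norm_eq_inner inner_diff inner_add inner_commute algebra_simps)
  also have "norm ?d \<le> \<sigma> * norm (y - x)"
  proof -
    have "norm (A x - A y) \<le> L * norm (y - x)"
      using lipschitz_onD[OF lip, of x y] by (simp add: dist_norm norm_minus_commute)
    then have "norm ?d \<le> c * (L * norm (y - x))"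
      using c by (simp add: mult_left_mono)
    also have "\<dots> \<le> \<sigma> * norm (y - x)"
      using c mult_right_mono[of "c * L" \<sigma> "norm (y - x)"] by (simp add: mult.assoc)
    finally show ?thesis .
  qed
  then have "(norm ?d)\<^sup>2 \<le> \<sigma>\<^sup>2 * (norm (y - x))\<^sup>2"
    by (metis norm_ge_zero power_mono power_mult_distrib)
  finally show ?thesis .
qed

text \<open>The point \<open>y\<close> is kept explicit, as membership in
  \<open>approx_resolvent\<close> would hide it: the decrease estimate must control this particular
  \<open>norm (y - x)\<close>.\<close>

lemma korpelevich_step:
  fixes x :: "'a::{real_inner, complete_space}"
  assumes "monotone_operator (singleton_map A)" "L-lipschitz_on UNIV A"
    and C: "C \<noteq> {}" "closed C" "convex C" and c: "0 \<le> c" "c * L \<le> \<sigma>"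
  defines "T \<equiv> op_scale c (op_add (singleton_map A) (normal_cone C))"
    and "y \<equiv> hilbert_proj C (x - c *\<^sub>R A x)"
    and "p \<equiv> (korpelevich_G C A c \<circ> korpelevich_H C A c) x"
  obtains \<epsilon> where "0 \<le> \<epsilon>" "x - p \<in> enlargement \<epsilon> T y"
    "(norm (x - p + y - x))\<^sup>2 + 2 * \<epsilon> \<le> \<sigma>\<^sup>2 * (norm (y - x))\<^sup>2"
proof
  let ?n = "x - c *\<^sub>R A y - p"
  let ?\<epsilon> = "inner ?n (p - y)"
  have p: "p = hilbert_proj C (x - c *\<^sub>R A y)"
    by (simp add: p_def y_def korpelevich_G_def korpelevich_H_def)
  have n: "?n \<in> normal_cone C p"
    unfolding p by (rule hilbert_proj_normal_cone[OF C])
  have m: "x - c *\<^sub>R A x - y \<in> normal_cone C y"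
    unfolding y_def by (rule hilbert_proj_normal_cone[OF C])
  show "0 \<le> ?\<epsilon>"
    using normal_coneD[OF n normal_cone_mem[OF m]] by (simp add: inner_diff_right)
  show "x - p \<in> enlargement ?\<epsilon> T y"
    using mem_enlargement_add_normal_cone[OF assms(1) c(1) normal_cone_mem[OF m] n]
    by (simp add: T_def)
  show "(norm (x - p + y - x))\<^sup>2 + 2 * ?\<epsilon> \<le> \<sigma>\<^sup>2 * (norm (y - x))\<^sup>2"
    using korpelevich_error[OF assms(2) c m normal_cone_mem[OF n]] .
qed

lemma korpelevich_approx_resolvent:
  assumes "monotone_operator (singleton_map A)" "L-lipschitz_on UNIV A"
    and "C \<noteq> {}" "closed C" "convex C" "0 \<le> c" "c * L \<le> \<sigma>"
  shows "(korpelevich_G C A c \<circ> korpelevich_H C A c) x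
    \<in> approx_resolvent (op_scale c (op_add (singleton_map A) (normal_cone C))) \<sigma> x"
    (is "?p \<in> _")
proof -
  obtain \<epsilon> where "0 \<le> \<epsilon>"
    "x - ?p \<in> enlargement \<epsilon> (op_scale c (op_add (singleton_map A) (normal_cone C)))
      (hilbert_proj C (x - c *\<^sub>R A x))"
    "(norm (x - ?p + hilbert_proj C (x - c *\<^sub>R A x) - x))\<^sup>2 + 2 * \<epsilon>
      \<le> \<sigma>\<^sup>2 * (norm (hilbert_proj C (x - c *\<^sub>R A x) - x))\<^sup>2"
    using korpelevich_step[OF assms] .
  then show ?thesis
    unfolding approx_resolvent_def by (intro CollectI exI[of _ "x - ?p"]) auto
qed

lemma korpelevich_decrease:
  assumes "monotone_operator (singleton_map A)" "L-lipschitz_on UNIV A"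
    and "C \<noteq> {}" "closed C" "convex C" "0 \<le> c" "c * L \<le> \<sigma>"
    and s: "s \<in> op_zeros (op_add (singleton_map A) (normal_cone C))"
  shows "(norm (s - (korpelevich_G C A c \<circ> korpelevich_H C A c) x))\<^sup>2
      + (1 - \<sigma>\<^sup>2) * (norm (hilbert_proj C (x - c *\<^sub>R A x) - x))\<^sup>2 \<le> (norm (s - x))\<^sup>2"
    (is "(norm (s - ?p))\<^sup>2 + _ \<le> _")
proof -
  have "s - (x - (x - ?p)) = s - ?p"
    by simp
  then show ?thesis
    using korpelevich_step[OF assms(1-7), of x]
      enlargement_step_decrease[OF _ _ op_zeros_op_scale[OF s]] by metis
qed

subsection \<open>Weak limits are solutions\<close>

text \<open>The inequality is applied at \<open>l + t m *\<^sub>R (q - l)\<close>, which convexity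
  keeps in \<open>C\<close>, and divided by \<open>t m > 0\<close>. As \<open>t m\<close> tends to
  0, continuity replaces the moving argument of \<open>A\<close> by \<open>l\<close>.\<close>

lemma minty_variational_inequality:
  assumes cont: "continuous_on UNIV A" and "convex C" "l \<in> C"
    and weak: "\<And>q. q \<in> C \<Longrightarrow> 0 \<le> inner (A q) (q - l)"
  shows "- A l \<in> normal_cone C l"
proof -
  have "0 \<le> inner (A l) (q - l)" if "q \<in> C" for q
  proof -
    define t where "t m = 1 / real (Suc m)" for m
    have t0: "t \<longlonglongrightarrow> 0"
      unfolding t_def by (rule LIMSEQ_Suc[OF lim_1_over_n])
    have "(\<lambda>m. l + t m *\<^sub>R (q - l)) \<longlonglongrightarrow> l + 0 *\<^sub>R (q - l)"
      by (intro tendsto_intros t0)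
    then have "(\<lambda>m. A (l + t m *\<^sub>R (q - l))) \<longlonglongrightarrow> A l"
      using continuous_on_tendsto_compose[OF cont] by force
    then have "(\<lambda>m. inner (A (l + t m *\<^sub>R (q - l))) (q - l)) \<longlonglongrightarrow> inner (A l) (q - l)"
      by (intro tendsto_intros)
    moreover have "0 \<le> inner (A (l + t m *\<^sub>R (q - l))) (q - l)" for m
    proof -
      have "0 < t m" "t m \<le> 1"
        by (auto simp: t_def)
      then have "(1 - t m) *\<^sub>R l + t m *\<^sub>R q \<in> C"
        using \<open>convex C\<close> \<open>l \<in> C\<close> that by (intro convexD) auto
      also have "(1 - t m) *\<^sub>R l + t m *\<^sub>R q = l + t m *\<^sub>R (q - l)"
        by (simp add: algebra_simps)
      finally have "0 \<le> t m * inner (A (l + t m *\<^sub>R (q - l))) (q - l)"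
        using weak by fastforce
      then show ?thesis
        using \<open>0 < t m\<close> by (simp add: zero_le_mult_iff)
    qed
    ultimately show ?thesis
      by (intro LIMSEQ_le_const) auto
  qed
  then show ?thesis
    using \<open>l \<in> C\<close> by (auto simp: normal_cone_def)
qed

lemma korpelevich_weak_limit:
  fixes z :: "nat \<Rightarrow> 'a::{real_inner, complete_space}"
  assumes mono: "monotone_operator (singleton_map A)" and lip: "L-lipschitz_on UNIV A"
    and C: "C \<noteq> {}" "closed C" "convex C"
    and weak: "weakly_converges z l" and lo: "0 < lo" "\<And>k. lo \<le> c k"
    and near: "(\<lambda>k. norm (hilbert_proj C (z k - c k *\<^sub>R A (z k)) - z k)) \<longlonglongrightarrow> 0"
  shows "- A l \<in> normal_cone C l"
proof -
  define y where "y k = hilbert_proj C (z k - c k *\<^sub>R A (z k))" for k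
  have m: "z k - c k *\<^sub>R A (z k) - y k \<in> normal_cone C (y k)" for k
    unfolding y_def by (rule hilbert_proj_normal_cone[OF C])
  have d0: "(\<lambda>k. norm (y k - z k)) \<longlonglongrightarrow> 0"
    using near by (simp add: y_def)
  then have d0': "(\<lambda>k. y k - z k) \<longlonglongrightarrow> 0"
    by (simp add: tendsto_norm_zero_iff)
  \<comment> \<open>\<open>y k\<close> is \<open>z k\<close> plus a strongly null term, so it has
    the same weak limit, and unlike \<open>z k\<close> it is known to lie in
    \<open>C\<close>.\<close>
  have "(\<lambda>k. inner u (z k) + inner u (y k - z k)) \<longlonglongrightarrow> inner u l + inner u 0" for u
    by (intro tendsto_add weakly_converges_inner[OF weak] tendsto_inner tendsto_const d0')
  then have "l \<in> C"
    using convex_closed_weak_limit[OF C(2,3), of y l] normal_cone_mem[OF m]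
    by (simp add: inner_diff_right)
  obtain B where B: "\<And>k. norm (z k) \<le> B"
    using weakly_converges_bounded[OF weak] by blast
  have weak_ineq: "0 \<le> inner (A q) (q - l)" if q: "q \<in> C" for q
  proof -
    \<comment> \<open>Every error term carries the factor \<open>norm (y k - z k)\<close>; its
      cofactor stays bounded because the \<open>z k\<close> are bounded, \<open>A\<close> is
      Lipschitz and \<open>c k \<ge> lo > 0\<close>.\<close>
    have "inner (A q) (q - z k)
        \<ge> - (norm (y k - z k) * ((norm q + B + norm (y k - z k)) / lo + norm (A 0) + L * B))" for k
    proof -
      let ?d = "norm (y k - z k)"
      have "0 \<le> L"
        using lip by (rule lipschitz_on_nonneg)
      have "norm (A (z k) - A 0) \<le> L * norm (z k)"
        using lipschitz_onD[OF lip, of "z k" 0] by (simp add: dist_norm)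
      also have "\<dots> \<le> L * B"
        using B \<open>0 \<le> L\<close> by (intro mult_left_mono) auto
      finally have "norm (A (z k)) \<le> norm (A 0) + L * B"
        using norm_triangle_ineq2[of "A (z k)" "A 0"] by linarith
      then have a: "\<bar>inner (A (z k)) (y k - z k)\<bar> \<le> ?d * (norm (A 0) + L * B)"
        using Cauchy_Schwarz_ineq2[of "A (z k)" "y k - z k"]
          mult_left_mono[of "norm (A (z k))" "norm (A 0) + L * B" ?d]
        by (simp add: mult.commute)
      have "norm (q - y k) \<le> norm q + B + ?d"
        using norm_triangle_ineq4[of q "y k"] norm_triangle_ineq2[of "y k" "z k"] B[of k]
        by linarith
      then have b: "\<bar>inner (z k - y k) (q - y k)\<bar> \<le> ?d * (norm q + B + ?d)"
        using Cauchy_Schwarz_ineq2[of "z k - y k" "q - y k"]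
          mult_left_mono[of "norm (q - y k)" "norm q + B + ?d" ?d]
        by (simp add: norm_minus_commute)
      have "0 < c k"
        using lo(1) lo(2)[of k] by linarith
      have "inner (z k - c k *\<^sub>R A (z k) - y k) (q - y k) \<le> 0"
        using normal_coneD[OF m q] .
      then have "inner (z k - y k) (q - y k) \<le> c k * inner (A (z k)) (q - y k)"
        by (simp add: inner_diff_left)
      then have "- (?d * (norm q + B + ?d)) \<le> c k * inner (A (z k)) (q - y k)"
        using b by linarith
      then have "- (?d * (norm q + B + ?d) / c k) \<le> inner (A (z k)) (q - y k)"
        using \<open>0 < c k\<close> by (simp add: field_simps)
      moreover have "?d * (norm q + B + ?d) / c k \<le> ?d * (norm q + B + ?d) / lo"
        using lo(1) lo(2)[of k] \<open>0 < c k\<close> order_trans[OF norm_ge_zero B[of k]]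
        by (intro divide_left_mono) auto
      \<comment> \<open>Monotonicity trades the moving vector \<open>A (z k)\<close>, whose weak
        limit is unknown, for the fixed \<open>A q\<close>, so that weak convergence of
        \<open>z\<close> suffices.\<close>
      moreover have "inner (A (z k)) (q - z k) \<le> inner (A q) (q - z k)"
        using singleton_map_monotoneD[OF mono, of q "z k"]
        by (simp add: inner_diff inner_commute algebra_simps)
      moreover have "inner (A (z k)) (q - z k)
          = inner (A (z k)) (q - y k) + inner (A (z k)) (y k - z k)"
        by (simp add: inner_diff_right)
      ultimately show ?thesis
        using a by (simp add: algebra_simps)
    qed
    moreover have "(\<lambda>k. - (norm (y k - z k)
          * ((norm q + B + norm (y k - z k)) / lo + norm (A 0) + L * B)))
        \<longlonglongrightarrow> - (0 * ((norm q + B + 0) / lo + norm (A 0) + L * B))"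
      using lo(1) by (intro tendsto_intros d0) auto
    moreover have "(\<lambda>k. inner (A q) (q - z k)) \<longlonglongrightarrow> inner (A q) (q - l)"
      unfolding inner_diff_right by (intro tendsto_diff tendsto_const weakly_converges_inner weak)
    ultimately show ?thesis
      using LIMSEQ_le by fastforce
  qed
  show ?thesis
    using minty_variational_inequality[OF lipschitz_on_continuous_on[OF lip] C(3) \<open>l \<in> C\<close> weak_ineq] .
qed

section \<open>From the one-step estimates to the resolvent inclusion, P1 and P2\<close>

theorem corollary7p2:
  fixes A :: "'a::{real_inner, complete_space} \<Rightarrow> 'a"
    and C :: "'a set"
    and L lam_min lam_max \<sigma> :: real
    and lam :: "nat \<Rightarrow> real"
    and x0 :: 'a
    and x y :: "nat \<Rightarrow> 'a"
  assumes "L > 0"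
    and "monotone_operator (singleton_map A)"
    and "L-lipschitz_on UNIV A"
    and "C \<noteq> {}" and "closed C" and "convex C"
    and "0 < lam_min" and "lam_min \<le> lam_max" and "lam_max < 1 / L"
    and "\<forall>k\<ge>1. lam k \<in> {lam_min..lam_max}"
    and "x 0 = x0"
    and "\<forall>k\<ge>1. y k = hilbert_proj C (x (k - 1) - lam k *\<^sub>R A (x (k - 1)))"
    and "\<forall>k\<ge>1. x k = hilbert_proj C (x (k - 1) - lam k *\<^sub>R A (y k))"
    and "\<sigma> = lam_max * L"
  shows "0 < \<sigma> \<and> \<sigma> < 1
    \<and> (\<forall>x'. \<forall>k\<ge>1. (korpelevich_G C A (lam k) \<circ> korpelevich_H C A (lam k)) x'
          \<in> approx_resolvent (op_scale (lam k) (op_add (singleton_map A) (normal_cone C))) \<sigma> x')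
    \<and> (\<forall>k\<ge>1. x k = (korpelevich_G C A (lam k) \<circ> korpelevich_H C A (lam k)) (x (k - 1))
          \<and> x k \<in> approx_resolvent (op_scale (lam k) (op_add (singleton_map A) (normal_cone C))) \<sigma>
                      (x (k - 1)))
    \<and> property_P1 (\<lambda>k. singleton_map (korpelevich_G C A (lam k) \<circ> korpelevich_H C A (lam k)))
        (op_zeros (op_add (singleton_map A) (normal_cone C)))
    \<and> property_P2 (\<lambda>k. singleton_map (korpelevich_G C A (lam k) \<circ> korpelevich_H C A (lam k)))
        (op_zeros (op_add (singleton_map A) (normal_cone C)))"
proof -
  let ?F = "\<lambda>k. korpelevich_G C A (lam k) \<circ> korpelevich_H C A (lam k)"
  let ?\<Omega> = "op_zeros (op_add (singleton_map A) (normal_cone C))"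
  note step_assms = assms(2-6)
  have \<sigma>: "0 < \<sigma>" "\<sigma> < 1"
    using assms(1,7-9,14) by (auto simp: field_simps)
  have lam: "0 \<le> lam k" "lam_min \<le> lam k" "lam k * L \<le> \<sigma>" if "k \<ge> 1" for k
    using assms(1,7,10,14) that by (force intro: mult_right_mono)+
  have res: "?F k u \<in> approx_resolvent (op_scale (lam k) (op_add (singleton_map A) (normal_cone C))) \<sigma> u"
    if "k \<ge> 1" for k u
    using korpelevich_approx_resolvent[OF step_assms lam(1,3)[OF that]] .
  have dec: "(norm (s - ?F k u))\<^sup>2
      + (1 - \<sigma>\<^sup>2) * (norm (hilbert_proj C (u - lam k *\<^sub>R A u) - u))\<^sup>2 \<le> (norm (s - u))\<^sup>2"
    if "k \<ge> 1" "s \<in> ?\<Omega>" for k u s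
    using korpelevich_decrease[OF step_assms lam(1,3)[OF that(1)] that(2)] .
  have \<sigma>2: "0 < 1 - \<sigma>\<^sup>2"
    using \<sigma> by (simp add: power_less_one_iff)
  have shrink: "norm (s - ?F k u) \<le> norm (s - u)" if "k \<ge> 1" "s \<in> ?\<Omega>" for k u s
  proof (rule power2_le_imp_le)
    have "0 \<le> (1 - \<sigma>\<^sup>2) * (norm (hilbert_proj C (u - lam k *\<^sub>R A u) - u))\<^sup>2"
      using \<sigma>2 by simp
    then show "(norm (s - ?F k u))\<^sup>2 \<le> (norm (s - u))\<^sup>2"
      using dec[OF that, of u] by linarith
  qed simp
  have x: "x k = ?F k (x (k - 1))" if "k \<ge> 1" for k
    using assms(12,13) that by (simp add: korpelevich_G_def korpelevich_H_def)
  have P1: "property_P1 (\<lambda>k. singleton_map (?F k)) ?\<Omega>"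
    using shrink by (auto simp: property_P1_def singleton_map_def)
  have P2: "property_P2 (\<lambda>k. singleton_map (?F k)) ?\<Omega>"
    unfolding property_P2_def
  proof (intro allI impI)
    fix z w :: "nat \<Rightarrow> 'a" and l and n :: "nat \<Rightarrow> nat"
    assume weak: "weakly_converges z l" and n: "\<forall>k. 1 \<le> n k"
      and "\<forall>k. w k \<in> singleton_map (?F (n k)) (z k)"
      and "\<exists>s\<in>?\<Omega>. (\<lambda>k. norm (s - z k) - norm (s - w k)) \<longlonglongrightarrow> 0"
    then obtain s where w: "\<And>k. w k = ?F (n k) (z k)" and s: "s \<in> ?\<Omega>"
      and lim: "(\<lambda>k. norm (s - z k) - norm (s - w k)) \<longlonglongrightarrow> 0"
      by (auto simp: singleton_map_def)
    obtain B where B: "\<And>k. norm (z k) \<le> B"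
      using weakly_converges_bounded[OF weak] by blast
    let ?d = "\<lambda>k. norm (hilbert_proj C (z k - lam (n k) *\<^sub>R A (z k)) - z k)"
    \<comment> \<open>The decrease estimate bounds
      \<open>(1 - \<sigma>\<^sup>2) * (?d k)\<^sup>2\<close> by a difference of squares. Factored,
      its sum factor is at most \<open>2 * (norm s + B)\<close>, and its difference factor is the
      one assumed to vanish.\<close>
    define K where "K = 2 * (norm s + B) / (1 - \<sigma>\<^sup>2)"
    have bound: "(?d k)\<^sup>2 \<le> K * (norm (s - z k) - norm (s - w k))" for k
    proof -
      have "norm (s - w k) \<le> norm (s - z k)"
        using shrink[OF _ s] n w by simp
      moreover have "norm (s - z k) \<le> norm s + B"
        using norm_triangle_ineq4[of s "z k"] B[of k] by linarith
      ultimately have "(norm (s - z k) - norm (s - w k)) * (norm (s - z k) + norm (s - w k))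
          \<le> (norm (s - z k) - norm (s - w k)) * (2 * (norm s + B))"
        by (intro mult_left_mono) auto
      moreover have "(1 - \<sigma>\<^sup>2) * (?d k)\<^sup>2
          \<le> (norm (s - z k) - norm (s - w k)) * (norm (s - z k) + norm (s - w k))"
        using dec[OF _ s, of "n k" "z k"] n w by (simp add: power2_eq_square algebra_simps)
      ultimately show ?thesis
        using \<sigma>2 by (simp add: K_def field_simps)
    qed
    have "(\<lambda>k. K * (norm (s - z k) - norm (s - w k))) \<longlonglongrightarrow> K * 0"
      by (intro tendsto_mult tendsto_const lim)
    then have "(\<lambda>k. (?d k)\<^sup>2) \<longlonglongrightarrow> 0"
      using tendsto_sandwich[OF _ always_eventually[OF allI[OF bound]] tendsto_const, of 0] by simp
    then have "?d \<longlonglongrightarrow> 0"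
      using tendsto_real_sqrt[of "\<lambda>k. (?d k)\<^sup>2" 0] by simp
    then have "- A l \<in> normal_cone C l"
      using korpelevich_weak_limit[OF step_assms weak assms(7), of "\<lambda>k. lam (n k)"] lam(2) n
      by blast
    then show "l \<in> ?\<Omega>"
      by (simp add: mem_op_zeros_add_normal_cone)
  qed
  have x_res: "x k \<in> approx_resolvent (op_scale (lam k) (op_add (singleton_map A) (normal_cone C))) \<sigma>
      (x (k - 1))" if "k \<ge> 1" for k
    using res[OF that, of "x (k - 1)"] unfolding x[OF that, symmetric] .
  show ?thesis
    using \<sigma> res x x_res P1 P2 by blast
qed

end
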